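(* Let $\mathcal C\subset\mathbb R^d$ be a relatively open convex set and let $\mathcal D=\{q_1,\dots,q_N\}\subset\mathbb R^d$ be a finite data set. Then $\mathcal D$ is a sufficient decision dataset for the uncertainty set $\mathcal C$ and decision set $\mathcal X$ if and only if $$\mathrm{dir}\big(\mathcal X^\star(\mathcal C)\big)\subset\mathrm{dir}(\mathcal C)^\perp+\mathrm{span}\,\mathcal D .$$
   Context: Let $A\in\mathbb R^{m\times d}$, $b\in\mathbb R^m$, and let $\mathcal X=\{x\in\mathbb R^d: Ax=b,\ x\ge 0\}$, assumed bounded. Sufficiency: $\mathcal D=\{q_1,\dots,q_N\}$ is a sufficient decision dataset for $\mathcal C$ and $\mathcal X$ if there is a map $\hat X:\mathbb R^N\to\mathcal P(\mathcal X)$ (the set of subsets of $\mathcal X$) such that $\hat X(c^\top q_1,\dots,c^\top q_N)=\arg\min_{x\in\mathcal X}c^\top x$ for all $c\in\mathcal C$. Reachable solutions: $\mathcal X^\star(\mathcal C)=\bigcup_{c\in\mathcal C}\arg\min_{x\in\mathcal X}c^\top x$. For a set $S\subset\mathbb R^d$, $\mathrm{dir}(S)=\mathrm{span}\{x_1-x_2:x_1,x_2\in S\}$. $S$ is relatively open if it equals its relative interior, i.e. every $x\in S$ has some $\varepsilon>0$ with $B(x,\varepsilon)\cap\mathrm{Aff}(S)\subset S$, where $\mathrm{Aff}(S)$ is the affine hull and $B(x,\varepsilon)$ the open Euclidean ball. $\perp$ denotes orthogonal complement. *)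

theory Defs
  imports "HOL-Analysis.Analysis" "HOL-Library.Set_Algebras"
begin

definition feasible :: "real^'d^'m \<Rightarrow> real^'m \<Rightarrow> (real^'d) set" where
  "feasible A b = {x. A *v x = b \<and> (\<forall>j. 0 \<le> x $ j)}"

definition argmin_set :: "'a::real_inner set \<Rightarrow> 'a \<Rightarrow> 'a set" where
  "argmin_set X c = {x. is_arg_min (\<lambda>y. c \<bullet> y) (\<lambda>y. y \<in> X) x}"

definition reachable :: "'a::real_inner set \<Rightarrow> 'a set \<Rightarrow> 'a set" where
  "reachable X C = (\<Union>c\<in>C. argmin_set X c)"

definition dir :: "'a::real_vector set \<Rightarrow> 'a set" where
  "dir S = span {x - y |x y. x \<in> S \<and> y \<in> S}"

(* The data q_1, ..., q_N are given as a list qs of length N, and R^N is represented by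
   the real lists of length N.  N = 0 and repeated data points are allowed. *)
definition sufficient_dataset ::
    "'a::real_inner set \<Rightarrow> 'a set \<Rightarrow> 'a list \<Rightarrow> bool" where
  "sufficient_dataset C X qs \<longleftrightarrow>
     (\<exists>Xhat :: real list \<Rightarrow> 'a set.
        (\<forall>v. length v = length qs \<longrightarrow> Xhat v \<subseteq> X) \<and>
        (\<forall>c\<in>C. Xhat (map (\<lambda>q. c \<bullet> q) qs) = argmin_set X c))"

end

theory Submission
  imports Defs
begin

text \<open>A subspace inclusion may be tested on orthogonal complements, so the condition says that every
  \<^term>\<open>u \<in> dir C\<close> orthogonal to the data is orthogonal to differences of reachable solutions.
  Two costs with equal data differ by such a \<^term>\<open>u\<close>, which gives one direction at once.  For the other,
  suppose that \<^term>\<open>u\<close> is invisible to the data.  Moving a cost along \<^term>\<open>u\<close> does not change its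
  minimizers; comparing minimizers \<open>x\<^sub>i\<close> of successive costs \<open>c\<^sub>i\<close> on a segment divided into
  \<^term>\<open>n\<close> equal parts bounds \<open>2\<epsilon>\<bar>u \<bullet> (x\<^sub>i - x\<^sub>i\<^sub>+\<^sub>1)\<bar>\<close> by
  \<open>(c\<^sub>i\<^sub>+\<^sub>1 - c\<^sub>i) \<bullet> (x\<^sub>i - x\<^sub>i\<^sub>+\<^sub>1)\<close>, and these bounds telescope to a quantity of
  order \<open>1/n\<close>.\<close>

section \<open>Minimizers over compact sets and closedness of the polyhedron\<close>

lemma mem_argmin_set_iff: "x \<in> argmin_set X c \<longleftrightarrow> x \<in> X \<and> (\<forall>y\<in>X. c \<bullet> x \<le> c \<bullet> y)"
  by (auto simp: argmin_set_def is_arg_min_linorder)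

lemma argmin_set_nonempty:
  assumes "compact X" "X \<noteq> {}"
  shows "argmin_set X c \<noteq> {}"
proof -
  have "continuous_on X (\<lambda>y. c \<bullet> y)"
    by (intro continuous_intros)
  from continuous_attains_inf[OF assms this] show ?thesis
    by (metis empty_iff mem_argmin_set_iff)
qed

lemma closed_feasible:
  fixes A :: "real^'d^'m"
  shows "closed (feasible A b)"
proof -
  have "feasible A b = {x. A *v x = b} \<inter> (\<Inter>j. {x. 0 \<le> x $ j})"
    by (auto simp: feasible_def)
  moreover have "closed {x. A *v x = b}"
    by (intro closed_Collect_eq continuous_intros matrix_vector_mult_linear_continuous_on)
  moreover have "closed (\<Inter>j. {x :: real^'d. 0 \<le> x $ j})"
    by (intro closed_INT ballI closed_Collect_le continuous_intros)
  ultimately show ?thesis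
    by (simp add: closed_Int)
qed

section \<open>Direction spaces and relatively open sets\<close>

lemma dir_subset_iff:
  assumes "subspace W"
  shows "dir S \<subseteq> W \<longleftrightarrow> (\<forall>x\<in>S. \<forall>y\<in>S. x - y \<in> W)"
proof
  show "\<forall>x\<in>S. \<forall>y\<in>S. x - y \<in> W" if "dir S \<subseteq> W"
    using that by (auto simp: dir_def intro: span_base)
  show "dir S \<subseteq> W" if "\<forall>x\<in>S. \<forall>y\<in>S. x - y \<in> W"
    unfolding dir_def using that by (intro span_minimal assms) auto
qed

lemma diff_mem_dir: "x \<in> S \<Longrightarrow> y \<in> S \<Longrightarrow> x - y \<in> dir S"
  by (auto simp: dir_def intro: span_base)

text \<open>The affine hull is \<open>c\<close> plus the span of all \<open>x - c\<close> with
  \<open>x\<close> in \<open>C\<close>, and \<open>x - y\<close> is a difference of two such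
  vectors.\<close>

lemma add_dir_mem_affine_hull:
  assumes "c \<in> C" "u \<in> dir C"
  shows "c + u \<in> affine hull C"
proof -
  have "dir C \<subseteq> span ((\<lambda>x. - c + x) ` C)"
  proof -
    have "x - y \<in> span ((\<lambda>x. - c + x) ` C)" if "x \<in> C" "y \<in> C" for x y
    proof -
      have "(- c + x) - (- c + y) \<in> span ((\<lambda>x. - c + x) ` C)"
        using that by (intro span_diff span_base) auto
      then show ?thesis by simp
    qed
    then show ?thesis by (simp add: dir_subset_iff)
  qed
  then show ?thesis
    using assms(2) affine_hull_span_gen[OF hull_inc[OF assms(1)]] by auto
qed

lemma rel_open_add_dir:
  fixes C :: "'a::euclidean_space set"
  assumes "rel_open C" "c \<in> C" "u \<in> dir C"
  obtains e where "e > 0" "\<And>t. \<bar>t\<bar> \<le> e \<Longrightarrow> c + t *\<^sub>R u \<in> C"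
proof -
  have "c \<in> rel_interior C"
    using assms by (simp add: rel_open_def)
  then obtain r where r: "r > 0" "cball c r \<inter> affine hull C \<subseteq> C"
    by (auto simp: mem_rel_interior_cball)
  \<comment> \<open>The summand \<open>1\<close> keeps the denominator positive when
    \<open>u = 0\<close>.\<close>
  define e where "e = r / (norm u + 1)"
  have "e > 0"
    using r by (simp add: e_def add_nonneg_pos)
  moreover have "c + t *\<^sub>R u \<in> C" if "\<bar>t\<bar> \<le> e" for t
  proof -
    have "norm (t *\<^sub>R u) \<le> e * (norm u + 1)"
      using that \<open>e > 0\<close> by (auto intro!: mult_mono)
    also have "\<dots> = r"
      by (simp add: e_def add_nonneg_eq_0_iff)
    finally have "c + t *\<^sub>R u \<in> cball c r"
      by (simp add: dist_norm)
    moreover have "t *\<^sub>R u \<in> dir C"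
      using assms(3) by (simp add: dir_def span_scale)
    ultimately show ?thesis
      using r add_dir_mem_affine_hull[OF assms(2)] by blast
  qed
  ultimately show thesis by (rule that)
qed

section \<open>Orthogonal complements of sums of subspaces\<close>

lemma subspace_set_plus:
  assumes "subspace S" "subspace T"
  shows "subspace (S + T)"
proof -
  have "S + T = {x + y |x y. x \<in> S \<and> y \<in> T}"
    by (auto simp: set_plus_def)
  then show ?thesis
    using subspace_sums[OF assms] by simp
qed

text \<open>In finite dimension a subspace is its own double orthogonal complement. The complement
  of the sum consists of the vectors of \<open>V\<close> that are orthogonal to \<open>Q\<close>,
  since complementing turns sums into intersections.\<close>

lemma mem_orthogonal_comp_plus_span_iff:
  fixes V Q :: "'a::euclidean_space set"
  assumes "subspace V"
  shows "z \<in> orthogonal_comp V + span Q \<longleftrightarrow>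
    (\<forall>u\<in>V. (\<forall>q\<in>Q. u \<bullet> q = 0) \<longrightarrow> u \<bullet> z = 0)"
proof -
  let ?W = "orthogonal_comp V + span Q"
  have W: "subspace ?W"
    by (intro subspace_set_plus subspace_orthogonal_comp subspace_span)
  have VV: "orthogonal_comp (orthogonal_comp V) = V"
    using assms by (rule orthogonal_comp_self)
  have perp: "u \<in> orthogonal_comp ?W \<longleftrightarrow> u \<in> V \<and> (\<forall>q\<in>Q. u \<bullet> q = 0)" for u
  proof
    assume u: "u \<in> orthogonal_comp ?W"
    have "u \<bullet> v = 0" if "v \<in> orthogonal_comp V" for v
    proof -
      have "v + 0 \<in> ?W" using that by (intro set_plus_intro span_zero)
      then show ?thesis using u by (auto simp: orthogonal_comp_def orthogonal_def inner_commute)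
    qed
    moreover have "u \<bullet> q = 0" if "q \<in> Q" for q
    proof -
      have "0 + q \<in> ?W"
        using that by (intro set_plus_intro span_base) (auto simp: orthogonal_comp_def orthogonal_def)
      then show ?thesis using u by (auto simp: orthogonal_comp_def orthogonal_def inner_commute)
    qed
    ultimately show "u \<in> V \<and> (\<forall>q\<in>Q. u \<bullet> q = 0)"
      by (subst VV[symmetric]) (auto simp: orthogonal_comp_def orthogonal_def inner_commute)
  next
    assume u: "u \<in> V \<and> (\<forall>q\<in>Q. u \<bullet> q = 0)"
    have "u \<bullet> s = 0" if "s \<in> span Q" for s
      using orthogonal_to_span[OF that, of u] u by (auto simp: orthogonal_def)
    moreover have "u \<bullet> v = 0" if "v \<in> orthogonal_comp V" for v
      using that u by (auto simp: orthogonal_comp_def orthogonal_def)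
    ultimately show "u \<in> orthogonal_comp ?W"
      by (auto simp: orthogonal_comp_def orthogonal_def set_plus_def inner_commute inner_add_right)
  qed
  have "z \<in> ?W \<longleftrightarrow> z \<in> orthogonal_comp (orthogonal_comp ?W)"
    by (simp add: orthogonal_comp_self[OF W])
  also have "\<dots> \<longleftrightarrow> (\<forall>u\<in>orthogonal_comp ?W. u \<bullet> z = 0)"
    by (auto simp: orthogonal_comp_def[of "orthogonal_comp ?W"] orthogonal_def)
  finally show ?thesis
    unfolding Ball_def perp by blast
qed

section \<open>Sufficiency as constancy of the minimizers on fibres of the data map\<close>

lemma sufficient_dataset_iff:
  "sufficient_dataset C X qs \<longleftrightarrow>
    (\<forall>c\<in>C. \<forall>c'\<in>C. (\<forall>q\<in>set qs. c \<bullet> q = c' \<bullet> q) \<longrightarrow> argmin_set X c = argmin_set X c')"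
proof
  assume "sufficient_dataset C X qs"
  then obtain Xhat where "\<forall>c\<in>C. Xhat (map (\<lambda>q. c \<bullet> q) qs) = argmin_set X c"
    by (auto simp: sufficient_dataset_def)
  moreover have "map (\<lambda>q. c \<bullet> q) qs = map (\<lambda>q. c' \<bullet> q) qs"
    if "\<forall>q\<in>set qs. c \<bullet> q = c' \<bullet> q" for c c'
    using that by simp
  ultimately show "\<forall>c\<in>C. \<forall>c'\<in>C. (\<forall>q\<in>set qs. c \<bullet> q = c' \<bullet> q) \<longrightarrow>
      argmin_set X c = argmin_set X c'"
    by metis
next
  assume eq: "\<forall>c\<in>C. \<forall>c'\<in>C. (\<forall>q\<in>set qs. c \<bullet> q = c' \<bullet> q) \<longrightarrow>
      argmin_set X c = argmin_set X c'"
  \<comment> \<open>The union runs over the fibre of the data map at \<open>v\<close>. All its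
    members agree by \<open>eq\<close>; an unattained \<open>v\<close> gets the empty set.\<close>
  define Xhat where "Xhat v = (\<Union>c\<in>{c\<in>C. map (\<lambda>q. c \<bullet> q) qs = v}. argmin_set X c)" for v
  have "Xhat v \<subseteq> X" for v
    by (auto simp: Xhat_def mem_argmin_set_iff)
  moreover have "Xhat (map (\<lambda>q. c \<bullet> q) qs) = argmin_set X c" if "c \<in> C" for c
  proof -
    have "argmin_set X c' = argmin_set X c"
      if "c' \<in> C" "map (\<lambda>q. c' \<bullet> q) qs = map (\<lambda>q. c \<bullet> q) qs" for c'
    proof -
      have "\<forall>q\<in>set qs. c' \<bullet> q = c \<bullet> q"
        using that(2) by simp
      with eq that(1) \<open>c \<in> C\<close> show ?thesis by blast
    qed
    then show ?thesis
      unfolding Xhat_def using that by blast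
  qed
  ultimately show "sufficient_dataset C X qs"
    unfolding sufficient_dataset_def by (intro exI[of _ Xhat]) auto
qed

text \<open>Both costs see the same gap between \<open>x\<close> and \<open>y\<close>, so
  \<open>x\<close> is no worse than the minimizer \<open>y\<close> for \<open>c'\<close>.\<close>

lemma argmin_set_mono_of_orthogonal:
  assumes "(c - c') \<bullet> (x - y) = 0" "x \<in> argmin_set X c" "y \<in> argmin_set X c'"
  shows "x \<in> argmin_set X c'"
proof -
  have "c \<bullet> x \<le> c \<bullet> y"
    using assms by (auto simp: mem_argmin_set_iff)
  then have "c' \<bullet> x \<le> c' \<bullet> y"
    using assms(1) by (simp add: inner_diff_left inner_diff_right)
  then show ?thesis
    using assms(2,3) by (force simp: mem_argmin_set_iff)
qed

text \<open>Compactness supplies a minimizer for \<open>c'\<close> with which a given minimizer for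
  \<open>c\<close> can be compared.\<close>

lemma argmin_set_subset_of_orthogonal:
  assumes "compact X" "c' \<in> C" "c \<in> C"
    and "\<And>x y. x \<in> reachable X C \<Longrightarrow> y \<in> reachable X C \<Longrightarrow> (c - c') \<bullet> (x - y) = 0"
  shows "argmin_set X c \<subseteq> argmin_set X c'"
proof
  fix x assume x: "x \<in> argmin_set X c"
  then have "X \<noteq> {}"
    by (auto simp: mem_argmin_set_iff)
  then obtain y where y: "y \<in> argmin_set X c'"
    using argmin_set_nonempty[OF assms(1)] by blast
  then have "(c - c') \<bullet> (x - y) = 0"
    using x assms(2,3) by (intro assms(4)) (auto simp: reachable_def)
  then show "x \<in> argmin_set X c'"
    using x y by (rule argmin_set_mono_of_orthogonal)
qed

section \<open>Minimizers along a segment of costs\<close>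

lemma abs_inner_argmin_diff_le:
  assumes "e \<ge> 0"
    and "\<And>t. \<bar>t\<bar> \<le> e \<Longrightarrow> x \<in> argmin_set X (c + t *\<^sub>R u)"
    and "\<And>t. \<bar>t\<bar> \<le> e \<Longrightarrow> y \<in> argmin_set X (c' + t *\<^sub>R u)"
  shows "2 * e * \<bar>u \<bullet> (x - y)\<bar> \<le> (c' - c) \<bullet> (x - y)"
proof -
  have X: "x \<in> X" "y \<in> X"
    using assms(2)[of 0] assms(3)[of 0] assms(1) by (auto simp: mem_argmin_set_iff)
  have "(c + t *\<^sub>R u) \<bullet> x \<le> (c + t *\<^sub>R u) \<bullet> y" "(c' + t *\<^sub>R u) \<bullet> y \<le> (c' + t *\<^sub>R u) \<bullet> x"
    if "\<bar>t\<bar> \<le> e" for t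
    using assms(2,3)[OF that] X by (auto simp: mem_argmin_set_iff)
  \<comment> \<open>For \<open>u \<bullet> (x - y) \<ge> 0\<close>, subtract the first inequality at
    \<open>t = e\<close> from the second at \<open>t = -e\<close>, both written in terms of
    \<open>x - y\<close>; each contributes one \<open>e\<close>. Otherwise the two shifts are
    exchanged.\<close>
  from this[of e] this[of "-e"] assms(1) show ?thesis
    by (cases "u \<bullet> (x - y) \<ge> 0") (auto simp: algebra_simps inner_diff_right)
qed

lemma inner_reachable_diff_eq_0:
  fixes C X :: "'a::euclidean_space set"
  assumes "compact X" "rel_open C" "convex C" "u \<in> dir C"
    and inv: "\<And>c t. c \<in> C \<Longrightarrow> c + t *\<^sub>R u \<in> C \<Longrightarrow> argmin_set X (c + t *\<^sub>R u) = argmin_set X c"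
    and "x \<in> reachable X C" "y \<in> reachable X C"
  shows "u \<bullet> (x - y) = 0"
proof -
  from assms obtain c c' where c: "c \<in> C" "c' \<in> C" "x \<in> argmin_set X c" "y \<in> argmin_set X c'"
    by (auto simp: reachable_def)
  have "X \<noteq> {}"
    using c by (auto simp: mem_argmin_set_iff)
  obtain e1 where e1: "e1 > 0" "\<And>t. \<bar>t\<bar> \<le> e1 \<Longrightarrow> c + t *\<^sub>R u \<in> C"
    using rel_open_add_dir[OF assms(2) c(1) assms(4)] by blast
  obtain e2 where e2: "e2 > 0" "\<And>t. \<bar>t\<bar> \<le> e2 \<Longrightarrow> c' + t *\<^sub>R u \<in> C"
    using rel_open_add_dir[OF assms(2) c(2) assms(4)] by blast
  \<comment> \<open>A margin that works at both endpoints works on the whole segment by convexity,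
    as \<open>pC\<close> shows.\<close>
  define e where "e = min e1 e2"
  have e: "e > 0" using e1 e2 by (simp add: e_def)
  define p where "p s = c + s *\<^sub>R (c' - c)" for s
  have pC: "p s + t *\<^sub>R u \<in> C" if "s \<in> {0..1}" "\<bar>t\<bar> \<le> e" for s t
  proof -
    have "(1 - s) *\<^sub>R (c + t *\<^sub>R u) + s *\<^sub>R (c' + t *\<^sub>R u) \<in> C"
      using that e1 e2 by (intro convexD[OF assms(3)]) (auto simp: e_def)
    then show ?thesis by (simp add: p_def algebra_simps)
  qed
  have "\<forall>s. \<exists>z. z \<in> argmin_set X (p s)"
    using argmin_set_nonempty[OF assms(1) \<open>X \<noteq> {}\<close>] by blast
  then obtain z0 where z0: "\<And>s. z0 s \<in> argmin_set X (p s)" by metis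
  \<comment> \<open>The minimizers in between are arbitrary, but the endpoints must be the given
    \<open>x\<close> and \<open>y\<close> for the sum to telescope to \<open>x - y\<close>.\<close>
  define z where "z = z0(0 := x, 1 := y)"
  have z: "z s \<in> argmin_set X (p s)" for s
    using z0 c by (auto simp: z_def p_def)
  \<comment> \<open>Both \<open>p s\<close> (by \<open>pC\<close> at \<open>t = 0\<close>) and its
    shift lie in \<open>C\<close>, so \<open>inv\<close> identifies their minimizers.\<close>
  have zt: "z s \<in> argmin_set X (p s + t *\<^sub>R u)" if "s \<in> {0..1}" "\<bar>t\<bar> \<le> e" for s t
    using pC[OF that] pC[of s 0] that e z[of s] inv[of "p s" t] by auto
  have bound: "real n * (2 * e * \<bar>u \<bullet> (x - y)\<bar>) \<le> (c' - c) \<bullet> (x - y)" if n: "n > 0" for n :: nat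
  proof -
    define w where "w i = z (real i / real n)" for i
    have w: "w 0 = x" "w n = y"
      using n by (auto simp: w_def z_def)
    \<comment> \<open>Consecutive costs differ by \<open>(c' - c) / n\<close>; clearing this
      denominator produces the factor \<open>n\<close> on the left.\<close>
    have step: "real n * (2 * e * \<bar>u \<bullet> (w i - w (Suc i))\<bar>) \<le> (c' - c) \<bullet> (w i - w (Suc i))"
      if "i < n" for i
    proof -
      have "2 * e * \<bar>u \<bullet> (w i - w (Suc i))\<bar>
          \<le> (p (real (Suc i) / real n) - p (real i / real n)) \<bullet> (w i - w (Suc i))"
        unfolding w_def using that e by (intro abs_inner_argmin_diff_le[where X = X] zt) auto
      also have "p (real (Suc i) / real n) - p (real i / real n) = (1 / real n) *\<^sub>R (c' - c)"
        by (simp add: p_def add_divide_distrib flip: scaleR_diff_left)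
      finally show ?thesis
        using n by (simp only: inner_scaleR_left) (simp add: field_simps)
    qed
    have tel: "(\<Sum>i<n. w i - w (Suc i)) = x - y"
      using sum_lessThan_telescope'[of w n] w by simp
    have "real n * (2 * e * \<bar>u \<bullet> (x - y)\<bar>) = real n * (2 * e * \<bar>\<Sum>i<n. u \<bullet> (w i - w (Suc i))\<bar>)"
      by (simp flip: tel inner_sum_right)
    also have "\<dots> \<le> real n * (2 * e * (\<Sum>i<n. \<bar>u \<bullet> (w i - w (Suc i))\<bar>))"
      using e by (intro mult_left_mono sum_abs) auto
    also have "\<dots> = (\<Sum>i<n. real n * (2 * e * \<bar>u \<bullet> (w i - w (Suc i))\<bar>))"
      by (simp only: sum_distrib_left)
    also have "\<dots> \<le> (\<Sum>i<n. (c' - c) \<bullet> (w i - w (Suc i)))"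
      using step by (intro sum_mono) auto
    also have "\<dots> = (c' - c) \<bullet> (x - y)"
      by (simp flip: tel inner_sum_right)
    finally show ?thesis .
  qed
  show ?thesis
  proof (rule ccontr)
    assume "u \<bullet> (x - y) \<noteq> 0"
    then have pos: "2 * e * \<bar>u \<bullet> (x - y)\<bar> > 0"
      using e by simp
    obtain n :: nat where n: "(c' - c) \<bullet> (x - y) < real n * (2 * e * \<bar>u \<bullet> (x - y)\<bar>)"
      using ex_less_of_nat_mult[OF pos] by blast
    \<comment> \<open>The \<open>n\<close> obtained may be \<open>0\<close>, where
      \<open>bound\<close> says nothing; \<open>Suc n\<close> is positive and keeps the strict
      inequality.\<close>
    then have "(c' - c) \<bullet> (x - y) < real (Suc n) * (2 * e * \<bar>u \<bullet> (x - y)\<bar>)"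
      using pos by (simp add: distrib_right)
    with bound[of "Suc n"] show False by simp
  qed
qed

section \<open>The equivalence for compact decision sets\<close>

lemma sufficient_dataset_iff_dir_subset:
  fixes C X :: "'a::euclidean_space set"
  assumes "compact X" "rel_open C" "convex C"
  shows "sufficient_dataset C X qs \<longleftrightarrow>
    dir (reachable X C) \<subseteq> orthogonal_comp (dir C) + span (set qs)"
proof -
  have dirC: "subspace (dir C)"
    by (simp add: dir_def)
  have W: "subspace (orthogonal_comp (dir C) + span (set qs))"
    by (intro subspace_set_plus subspace_orthogonal_comp subspace_span)
  have "dir (reachable X C) \<subseteq> orthogonal_comp (dir C) + span (set qs) \<longleftrightarrow>
      (\<forall>x\<in>reachable X C. \<forall>y\<in>reachable X C. \<forall>u\<in>dir C.
        (\<forall>q\<in>set qs. u \<bullet> q = 0) \<longrightarrow> u \<bullet> (x - y) = 0)" (is "_ \<longleftrightarrow> ?orth")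
    by (simp only: dir_subset_iff[OF W] mem_orthogonal_comp_plus_span_iff[OF dirC])
  also have "?orth \<longleftrightarrow> sufficient_dataset C X qs"
  proof
    assume orth: ?orth
    \<comment> \<open>One inclusion suffices, because \<open>c\<close> and \<open>c'\<close> play
      symmetric roles.\<close>
    have "argmin_set X c \<subseteq> argmin_set X c'"
      if "c \<in> C" "c' \<in> C" "\<forall>q\<in>set qs. c \<bullet> q = c' \<bullet> q" for c c'
    proof (rule argmin_set_subset_of_orthogonal[OF assms(1) that(2,1)])
      fix x y assume "x \<in> reachable X C" "y \<in> reachable X C"
      moreover have "\<forall>q\<in>set qs. (c - c') \<bullet> q = 0"
        using that(3) by (simp add: inner_diff_left)
      ultimately show "(c - c') \<bullet> (x - y) = 0"
        using orth diff_mem_dir[OF that(1,2)] by blast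
    qed
    then show "sufficient_dataset C X qs"
      unfolding sufficient_dataset_iff by (metis subset_antisym)
  next
    assume suff: "sufficient_dataset C X qs"
    show ?orth
    proof (intro ballI impI)
      fix x y u
      assume *: "x \<in> reachable X C" "y \<in> reachable X C" "u \<in> dir C" "\<forall>q\<in>set qs. u \<bullet> q = 0"
      \<comment> \<open>Since \<open>u\<close> is orthogonal to the data, a shift along
        \<open>u\<close> leaves all observations unchanged; this is the invariance that the segment
        argument requires.\<close>
      have "argmin_set X (c + t *\<^sub>R u) = argmin_set X c" if "c \<in> C" "c + t *\<^sub>R u \<in> C" for c t
      proof -
        have "\<forall>q\<in>set qs. (c + t *\<^sub>R u) \<bullet> q = c \<bullet> q"
          using *(4) by (simp add: inner_add_left)
        with suff that show ?thesis
          unfolding sufficient_dataset_iff by blast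
      qed
      then show "u \<bullet> (x - y) = 0"
        using assms * by (intro inner_reachable_diff_eq_0[of X C]) auto
    qed
  qed
  finally show ?thesis by blast
qed

theorem theorem3:
  fixes A :: "real^'d^'m" and b :: "real^'m"
    and C :: "(real^'d) set" and qs :: "(real^'d) list"
  assumes "bounded (feasible A b)"
    and "rel_open C" and "convex C"
  shows "sufficient_dataset C (feasible A b) qs \<longleftrightarrow>
    dir (reachable (feasible A b) C) \<subseteq> orthogonal_comp (dir C) + span (set qs)"
proof -
  have "compact (feasible A b)"
    using assms(1) closed_feasible by (simp add: compact_eq_bounded_closed)
  then show ?thesis
    using assms(2,3) by (rule sufficient_dataset_iff_dir_subset)
qed

end
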